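(* Let $\sum_{n=1}^{\infty}x_n$ be a convergent series of positive terms with remainders $r_n=\sum_{k=n+1}^{\infty}x_k$ ($n\ge 0$), and suppose it has property (B). Define $y_{2n-1}=r_{n-1}$ and $y_{2n}=x_n$ for each $n\in\mathbb{N}$, and let $f$ be the cardinal function of the series $\sum_{n=1}^{\infty}y_n$. Then: (1) $f(r_n)=\omega$ for every $n\in\mathbb{N}$. Moreover, if $\sum_{n=1}^{\infty}x_n$ has property (A), then: (2) $f(x_n)=1$ for every $n\in\mathbb{N}$; (3) $f\big(\sum_{n\in F}x_n\big)=1$ for each $F\subset\mathbb{N}$ such that $|\mathbb{N}\setminus F|=\infty$; (4) $f\big(\sum_{n\in F}x_n\big)=\omega$ for each $F\subset\mathbb{N}$ such that $1\leq|\mathbb{N}\setminus F|<\infty$; (5) there are continuum many points $t$ such that $f(t)=\mathfrak{c}$; (6) $R(f)=\{1,2,\ldots,k,\ldots,\omega,\mathfrak{c}\}$, i.e. $R(f)$ consists of all positive integers together with $\omega$ and $\mathfrak c$.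
   Context: $\mathbb{N}=\{1,2,3,\dots\}$; $\omega$ is the countably infinite cardinal and $\mathfrak{c}$ the cardinality of the continuum. For a convergent series $\sum_{n=1}^\infty x_n$ of positive terms put $r_n=\sum_{k=n+1}^{\infty}x_k$ for $n\ge 0$ (so $r_0=\sum_{k=1}^\infty x_k$). The series has property (A) if $x_i>\sum_{n=i+1}^{\infty}(x_n+r_{n-1})$ for each $i\in\mathbb{N}$, and property (B) if $r_{i-1}>\sum_{n=i+1}^{\infty}(x_n+r_{n-1})$ for each $i\in\mathbb{N}$. (Property (A) implies property (B), since $r_{i-1}>x_i$.) The cardinal function of a convergent series $\sum_{n=1}^\infty y_n$ of positive terms is $f(t)=|\{A\subset\mathbb{N}:\sum_{n\in A}y_n=t\}|$, and $R(f)$ is the set of all cardinals $f(t)$ for $t$ in $\{\sum_{n\in A}y_n:A\subset\mathbb{N}\}$. *)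

theory Defs
  imports "HOL-Analysis.Analysis" "HOL-Library.Equipollence"
begin

text \<open>
  Sequences are indexed by \<open>{1..}\<close>; the value of a sequence at \<open>0\<close> is never used.
  A full series is summed by \<open>suminf\<close>; a sum over an index set \<open>A\<close> is the unordered sum
  (\<open>has_sum\<close>, \<open>infsum\<close>), which for positive terms is independent of the order.
\<close>

text \<open>The term \<open>k = 0\<close> of the sum is \<open>x (n + 1)\<close>, so \<open>remainder x 0\<close> is the whole series.\<close>
definition remainder :: "(nat \<Rightarrow> real) \<Rightarrow> nat \<Rightarrow> real" where
  "remainder x n = (\<Sum>k. x (n + 1 + k))"

text \<open>
  Below, \<open>k\<close> stands for \<open>n - (i + 1)\<close> in the sum over \<open>n\<close> from \<open>i + 1\<close> to infinity of
  \<open>x n + remainder x (n - 1)\<close>.  A divergent series of positive terms has sum \<open>\<infinity>\<close>, so the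
  strict inequalities include convergence; it has to be stated because \<open>suminf\<close> is unspecified
  on divergent series.
\<close>
definition property_A :: "(nat \<Rightarrow> real) \<Rightarrow> bool" where
  "property_A x \<longleftrightarrow> (\<forall>i\<ge>1. summable (\<lambda>k. x (i + 1 + k) + remainder x (i + k)) \<and>
     x i > (\<Sum>k. x (i + 1 + k) + remainder x (i + k)))"

definition property_B :: "(nat \<Rightarrow> real) \<Rightarrow> bool" where
  "property_B x \<longleftrightarrow> (\<forall>i\<ge>1. summable (\<lambda>k. x (i + 1 + k) + remainder x (i + k)) \<and>
     remainder x (i - 1) > (\<Sum>k. x (i + 1 + k) + remainder x (i + k)))"

text \<open>
  A cardinal is the class of all equipollent sets, taken among the sets of subsets of \<open>nat\<close>.
  This represents exactly the cardinals up to the continuum (the class of a larger set would be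
  empty); all sets below have at most that size, see \<open>cardinal_of_eq_iff\<close>.
\<close>
type_synonym cardinal = "nat set set set"

definition cardinal_of :: "'a set \<Rightarrow> cardinal" where
  "cardinal_of A = {B. A \<approx> B}"

lemma cardinal_of_eq_iff:
  assumes "A \<lesssim> (UNIV :: nat set set)"
  shows "cardinal_of A = cardinal_of B \<longleftrightarrow> A \<approx> B"
proof
  assume eq: "cardinal_of A = cardinal_of B"
  obtain f :: "'a \<Rightarrow> nat set" where "inj_on f A"
    using assms by (auto simp: lepoll_def)
  then have "A \<approx> f ` A" by (rule eqpoll_sym [OF inj_on_image_eqpoll_self])
  then obtain C :: "nat set set" where "A \<approx> C" by blast
  then have "C \<in> cardinal_of A" by (simp add: cardinal_of_def)
  then have "C \<in> cardinal_of B" by (simp only: eq)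
  then have "B \<approx> C" by (simp add: cardinal_of_def)
  with \<open>A \<approx> C\<close> show "A \<approx> B" by (blast intro: eqpoll_trans eqpoll_sym)
next
  assume "A \<approx> B"
  then show "cardinal_of A = cardinal_of B"
    unfolding cardinal_of_def by (auto intro: eqpoll_trans eqpoll_sym)
qed

definition card_fin :: "nat \<Rightarrow> cardinal" where
  "card_fin k = cardinal_of {..<k}"

definition card_omega :: cardinal where
  "card_omega = cardinal_of (UNIV :: nat set)"

definition card_continuum :: cardinal where
  "card_continuum = cardinal_of (UNIV :: real set)"

definition cardinal_function :: "(nat \<Rightarrow> real) \<Rightarrow> real \<Rightarrow> cardinal" where
  "cardinal_function y t = cardinal_of {A. A \<subseteq> {1..} \<and> (y has_sum t) A}"

definition subsums :: "(nat \<Rightarrow> real) \<Rightarrow> real set" where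
  "subsums y = {t. \<exists>A\<subseteq>{1..}. (y has_sum t) A}"

definition cardinal_range :: "(nat \<Rightarrow> real) \<Rightarrow> cardinal set" where
  "cardinal_range y = cardinal_function y ` subsums y"

end

theory Submission imports Defs begin

text \<open>
  Group the terms of \<open>y\<close> into levels, the \<open>(i + 1)\<close>-st consisting of \<open>r i\<close> and
  \<open>x (i + 1)\<close>, and let \<open>S i\<close> be the sum of all terms beyond the \<open>i\<close>-th level.
  The only relation between the terms is \<open>r i = x (i + 1) + r (i + 1)\<close>; (B) says
  \<open>S (i + 1) < r i\<close> and (A) says \<open>S (i + 1) < x (i + 1)\<close>.  Under (A), if two index sets have the
  same sum, then at the first level where they differ one of them contains \<open>r i\<close> and the other
  one \<open>x (i + 1)\<close> instead.  For (2)-(4) this leaves only the \<open>x\<close>-representation itself and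
  those obtained from it by collapsing a full final segment of \<open>x\<close>-terms into one remainder; for (1),
  (B) already suffices, because \<open>r n\<close> is the sum of a full final segment.
  The same analysis finds exactly \<open>k\<close> representations of \<open>r 0 + (r k + x (k + 1))\<close>,
  since \<open>r 0\<close> can be unfolded up to level \<open>k\<close> but no further.
  For the continuum, the unfolding is done independently in infinitely many disjoint blocks.
  No other infinite cardinals occur, because the set of representations of a number is
  closed in the Cantor space.
\<close>

section \<open>Cardinalities of solution sets\<close>

text \<open>Cantor-Bendixson argument: discarding all basic open sets that meet \<open>S\<close> in
  a countable set removes only countably many points of \<open>S\<close>, and the rest
  \<open>K\<close> is nonempty and perfect.\<close>

lemma uncountable_closed_lepoll:
  fixes S :: "'a :: polish_space set"
  assumes "closed S" "uncountable S"
  shows "(UNIV :: real set) \<lesssim> S"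
proof -
  obtain \<B> :: "'a set set" where \<B>: "countable \<B>" "topological_basis \<B>"
    using ex_countable_basis by blast
  define N where "N = \<Union>{U \<in> \<B>. countable (U \<inter> S)}"
  define K where "K = S - N"
  have "countable (\<Union>U\<in>{U \<in> \<B>. countable (U \<inter> S)}. U \<inter> S)"
    using \<B>(1) by (intro countable_UN) auto
  moreover have "(\<Union>U\<in>{U \<in> \<B>. countable (U \<inter> S)}. U \<inter> S) = N \<inter> S"
    by (auto simp: N_def)
  ultimately have N: "countable (N \<inter> S)"
    by simp
  have "open N"
    unfolding N_def using \<B>(2) by (auto intro: topological_basis_open)
  then have "closed K"
    unfolding K_def using assms(1) by (intro closed_Diff)
  have "K \<noteq> {}"
  proof
    assume "K = {}"
    then have "N \<inter> S = S" by (auto simp: K_def)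
    with N assms(2) show False by simp
  qed
  have "x islimpt K" if "x \<in> K" for x
    unfolding islimpt_def
  proof (intro allI impI)
    fix T assume T: "x \<in> T" "open T"
    obtain U where U: "U \<in> \<B>" "x \<in> U" "U \<subseteq> T"
      using topological_basisE[OF \<B>(2) T(2,1)] by blast
    have "uncountable (U \<inter> S)"
      using U that by (auto simp: K_def N_def)
    then have "uncountable (U \<inter> S - (insert x (N \<inter> S)))"
      using N by (intro uncountable_minus_countable) auto
    then obtain z where "z \<in> U \<inter> S - (insert x (N \<inter> S))"
      by (metis countable_empty ex_in_conv)
    then show "\<exists>z\<in>K. z \<in> T \<and> z \<noteq> x"
      using U by (auto simp: K_def)
  qed
  then have "euclidean derived_set_of K = K"
  proof -
    have "x \<in> euclidean derived_set_of K \<longleftrightarrow> x islimpt K" for x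
      by (auto simp: in_derived_set_of islimpt_def)
    with \<open>closed K\<close> \<open>\<And>x. x \<in> K \<Longrightarrow> x islimpt K\<close> show ?thesis
      by (auto simp: closed_limpt)
  qed
  then have "(UNIV :: real set) \<lesssim> K"
    using \<open>K \<noteq> {}\<close> by (intro lepoll_perfect_set[of euclidean]) (auto intro: completely_metrizable_space_euclidean)
  also have "K \<lesssim> S"
    by (rule subset_imp_lepoll) (auto simp: K_def)
  finally show ?thesis .
qed

text \<open>The subsum depends continuously on the indicator function: by the M-test with bounds
  \<open>\<bar>y n\<bar>\<close> it is a uniform limit of finite sums.\<close>

lemma closed_indicators_infsum:
  fixes y :: "nat \<Rightarrow> real"
  assumes "y summable_on X"
  shows "closed (indicator ` {A. A \<subseteq> X \<and> infsum y A = t} :: (nat \<Rightarrow> real) set)"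
proof -
  \<comment> \<open>The copy of the Cantor space of subsets of \<open>X\<close> inside the Polish
    space of all real sequences.\<close>
  define D :: "(nat \<Rightarrow> real) set" where "D = {h. \<forall>n. h n \<in> (if n \<in> X then {0, 1} else {0})}"
  define \<sigma> :: "(nat \<Rightarrow> real) \<Rightarrow> real" where "\<sigma> = (\<lambda>h. \<Sum>\<^sub>\<infinity>n\<in>X. h n * y n)"
  have cont: "continuous_on UNIV (\<lambda>h :: nat \<Rightarrow> real. h n)" for n
    by (rule continuous_on_product_coordinates)
  have "closed ((\<lambda>h :: nat \<Rightarrow> real. h n) -` (if n \<in> X then {0, 1} else {0}))" for n
    by (intro closed_vimage cont) auto
  moreover have "D = (\<Inter>n. (\<lambda>h. h n) -` (if n \<in> X then {0, 1} else {0}))"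
    unfolding D_def by blast
  ultimately have "closed D"
    by (simp only:) (intro closed_INT, simp)
  have "uniform_limit D (\<lambda>F h. \<Sum>n\<in>F. h n * y n) \<sigma> (finite_subsets_at_top X)"
    unfolding \<sigma>_def
  proof (rule Weierstrass_m_test_general)
    show "norm (h n * y n) \<le> \<bar>y n\<bar>" if "h \<in> D" for h n
    proof -
      have "h n = 0 \<or> h n = 1" using that by (auto simp: D_def split: if_splits)
      then show ?thesis by auto
    qed
    show "(\<lambda>n. \<bar>y n\<bar>) summable_on X"
      using assms summable_on_iff_abs_summable_on_real by force
  qed
  then have "continuous_on D \<sigma>"
    by (rule uniform_limit_theorem[rotated])
       (auto intro!: always_eventually continuous_on_sum continuous_on_mult continuous_on_const
          continuous_on_subset[OF cont])
  then have "closed (D \<inter> \<sigma> -` {t})"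
    using \<open>closed D\<close> by (intro continuous_closed_preimage) auto
  also have "D \<inter> \<sigma> -` {t} = indicator ` {A. A \<subseteq> X \<and> infsum y A = t}"
  proof -
    have \<sigma>_indicator: "\<sigma> (indicator A) = infsum y A" if "A \<subseteq> X" for A
      unfolding \<sigma>_def using that
      by (intro infsum_cong_neutral) (auto simp: indicator_def)
    have "\<exists>A\<subseteq>X. h = indicator A" if "h \<in> D" for h
    proof -
      have "h n = 0 \<or> h n = 1" "n \<notin> X \<Longrightarrow> h n \<noteq> 1" for n
        using that by (auto simp: D_def split: if_splits)
      then show ?thesis
        by (intro exI[of _ "{n. h n = 1}"]) (auto simp: indicator_def fun_eq_iff)
    qed
    moreover have "indicator A \<in> D" if "A \<subseteq> X" for A
      using that by (auto simp: D_def indicator_def)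
    ultimately show ?thesis
      using \<sigma>_indicator by (auto simp: image_iff) (metis \<sigma>_indicator)
  qed
  finally show ?thesis .
qed

text \<open>This rules out cardinals strictly between \<open>\<omega>\<close> and the continuum
  without the continuum hypothesis.\<close>

lemma lepoll_sets_infsum_eq:
  fixes y :: "nat \<Rightarrow> real"
  assumes "y summable_on X" "uncountable {A. A \<subseteq> X \<and> infsum y A = t}"
  shows "(UNIV :: real set) \<lesssim> {A. A \<subseteq> X \<and> infsum y A = t}"
proof -
  let ?R = "{A. A \<subseteq> X \<and> infsum y A = t}"
  let ?I = "indicator :: nat set \<Rightarrow> nat \<Rightarrow> real"
  have "inj ?I"
    by (metis injI indicator_eq_1_iff subsetI subset_antisym)
  then have eq: "?I ` ?R \<approx> ?R"
    by (rule inj_on_image_eqpoll_self[OF inj_on_subset[OF _ subset_UNIV]])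
  then have "uncountable (?I ` ?R)"
    using assms(2) countable_eqpoll eqpoll_sym by blast
  then have "(UNIV :: real set) \<lesssim> ?I ` ?R"
    by (intro uncountable_closed_lepoll closed_indicators_infsum assms(1))
  then show ?thesis
    using eq lepoll_trans2 by blast
qed

lemma cardinal_of_cong: "A \<approx> B \<Longrightarrow> cardinal_of A = cardinal_of B"
  unfolding cardinal_of_def by (auto intro: eqpoll_trans eqpoll_sym)

lemma countable_infinite_cardinal_of:
  assumes "countable A" "infinite A"
  shows "cardinal_of A = card_omega"
  unfolding card_omega_def
  using assms by (intro cardinal_of_cong)
    (meson countableE_infinite bij_betw_imp_surj_on eqpoll_def)

lemma finite_cardinal_of: "finite A \<Longrightarrow> cardinal_of A = card_fin (card A)"
  unfolding card_fin_def by (intro cardinal_of_cong) (simp add: eqpoll_iff_finite_card)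

lemma cardinal_of_continuum:
  assumes "(UNIV :: nat set set) \<lesssim> A" "A \<lesssim> (UNIV :: nat set set)"
  shows "cardinal_of A = card_continuum"
  unfolding card_continuum_def
  using assms by (intro cardinal_of_cong) (meson eqpoll_trans lepoll_antisym nat_sets_eqpoll_reals)

section \<open>Tails of the interleaved series\<close>

lemma remainder_has_sum:
  assumes "\<And>n. n \<ge> 1 \<Longrightarrow> x n > 0" "summable x"
  shows "(x has_sum remainder x n) {n<..}"
proof -
  have "summable (\<lambda>k. x (k + (n + 1)))"
    using assms(2) by (rule summable_ignore_initial_segment)
  then have "(\<lambda>k. x (n + 1 + k)) sums remainder x n"
    unfolding remainder_def by (simp add: add_ac summable_sums)
  then have "((\<lambda>k. x (n + 1 + k)) has_sum remainder x n) UNIV"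
    using assms(1) by (intro sums_nonneg_imp_has_sum) (auto intro: less_imp_le)
  moreover have "bij_betw (\<lambda>k. n + 1 + k) UNIV {n<..}"
    by (rule bij_betwI[of _ _ _ "\<lambda>m. m - (n + 1)"]) auto
  ultimately show ?thesis
    using has_sum_reindex_bij_betw by blast
qed

locale interleaved =
  fixes x y :: "nat \<Rightarrow> real"
  assumes pos: "\<And>n. n \<ge> 1 \<Longrightarrow> x n > 0"
    and conv: "summable x"
    and B: "property_B x"
    and y_odd: "\<And>n. n \<ge> 1 \<Longrightarrow> y (2 * n - 1) = remainder x (n - 1)"
    and y_even: "\<And>n. n \<ge> 1 \<Longrightarrow> y (2 * n) = x n"
begin

abbreviation r :: "nat \<Rightarrow> real" where "r \<equiv> remainder x"

definition tail :: "nat \<Rightarrow> nat set \<Rightarrow> real" where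
  "tail i A = infsum y (A \<inter> {2 * i<..})"

abbreviation S :: "nat \<Rightarrow> real" where "S i \<equiv> tail i UNIV"

definition reps :: "real \<Rightarrow> nat set set" where
  "reps t = {A. A \<subseteq> {1..} \<and> infsum y A = t}"

lemma y_Suc_double: "y (Suc (2 * i)) = r i"
  using y_odd[of "Suc i"] by simp

lemma y_Suc_Suc_double: "y (Suc (Suc (2 * i))) = x (Suc i)"
  using y_even[of "Suc i"] by simp

lemma x_has_sum: "(x has_sum r n) {n<..}"
  using pos conv by (rule remainder_has_sum)

lemma x_summable: "F \<subseteq> {1..} \<Longrightarrow> x summable_on F"
  using has_sum_imp_summable[OF x_has_sum[of 0]]
  by (rule summable_on_subset_banach) (auto simp: Suc_le_eq)

lemma r_Suc: "r i = x (Suc i) + r (Suc i)"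
proof -
  have "(x has_sum (x (Suc i) + r (Suc i))) ({Suc i} \<union> {Suc i<..})"
    by (intro has_sum_Un_disjoint x_has_sum has_sum_finiteI) auto
  also have "{Suc i} \<union> {Suc i<..} = {i<..}" by auto
  finally show ?thesis
    using x_has_sum has_sum_unique by blast
qed

lemma r_pos: "r i > 0"
proof -
  have "r i \<ge> 0" for i
    using x_has_sum
  proof (rule has_sum_nonneg)
    show "x n \<ge> 0" if "n \<in> {i<..}" for n
      using that pos[of n] by auto
  qed
  from this[of "Suc i"] show ?thesis
    using pos[of "Suc i"] r_Suc[of i] by simp
qed

lemma y_pos:
  assumes "n \<ge> 1"
  shows "y n > 0"
proof (cases "even n")
  case True
  then obtain k where "n = 2 * k" by blast
  then show ?thesis using assms y_even[of k] pos[of k] by simp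
next
  case False
  then obtain k where "n = Suc (2 * k)" by (auto elim: oddE)
  then show ?thesis using y_Suc_double r_pos by simp
qed

text \<open>Positivity lets the series of (A) and (B) be split into its \<open>x\<close> and
  \<open>r\<close> parts, which are the even and the odd indices of \<open>y\<close> beyond
  \<open>2 * i\<close>.\<close>

lemma y_has_sum_tail:
  assumes "summable (\<lambda>k. x (i + 1 + k) + r (i + k))"
  shows "(y has_sum (\<Sum>k. x (i + 1 + k) + r (i + k))) {2 * i<..}"
proof -
  have x_nonneg: "x (i + 1 + k) \<ge> 0" and r_nonneg: "r (i + k) \<ge> 0" for k
    using pos[of "i + 1 + k"] r_pos[of "i + k"] by auto
  have sx: "summable (\<lambda>k. x (i + 1 + k))"
    by (rule summable_comparison_test'[OF assms, of 0]) (use x_nonneg r_nonneg in auto)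
  have sr: "summable (\<lambda>k. r (i + k))"
    by (rule summable_comparison_test'[OF assms, of 0]) (use x_nonneg r_nonneg in auto)
  have "((\<lambda>k. x (i + 1 + k)) has_sum (\<Sum>k. x (i + 1 + k))) UNIV"
    using sx x_nonneg by (intro sums_nonneg_imp_has_sum) (auto simp: summable_sums)
  then have "((\<lambda>k. y (2 * (i + 1 + k))) has_sum (\<Sum>k. x (i + 1 + k))) UNIV"
    by (simp only: y_even[OF trans_le_add1[OF le_add2]])
  moreover have "((\<lambda>k. r (i + k)) has_sum (\<Sum>k. r (i + k))) UNIV"
    using sr r_nonneg by (intro sums_nonneg_imp_has_sum) (auto simp: summable_sums)
  then have "((\<lambda>k. y (Suc (2 * (i + k)))) has_sum (\<Sum>k. r (i + k))) UNIV"
    by (simp only: y_Suc_double)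
  ultimately have "(y has_sum (\<Sum>k. x (i + 1 + k)) + (\<Sum>k. r (i + k)))
    (range (\<lambda>k. 2 * (i + 1 + k)) \<union> range (\<lambda>k. Suc (2 * (i + k))))"
    by (intro has_sum_Un_disjoint)
       (use double_not_eq_Suc_double Suc_double_not_eq_double in \<open>auto simp: has_sum_reindex inj_on_def o_def\<close>)
  also have "range (\<lambda>k. 2 * (i + 1 + k)) \<union> range (\<lambda>k. Suc (2 * (i + k))) = {2 * i<..}" (is "?L = ?R")
  proof
    show "?R \<subseteq> ?L"
    proof
      fix n assume "n \<in> ?R"
      then have "n = 2 * (i + 1 + (n div 2 - i - 1)) \<or> n = Suc (2 * (i + (n div 2 - i)))"
        by simp presburger
      then show "n \<in> ?L" by blast
    qed
  qed auto
  finally show ?thesis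
    using sx sr by (simp add: suminf_add)
qed

lemma B_summable: "i \<ge> 1 \<Longrightarrow> summable (\<lambda>k. x (i + 1 + k) + r (i + k))"
  using B unfolding property_B_def by blast

text \<open>Convergence of \<open>y\<close> comes from (B) at \<open>i = 1\<close>; only the two
  terms of the first level have to be added.\<close>

lemma y_summable: "A \<subseteq> {1..} \<Longrightarrow> y summable_on A"
proof (rule summable_on_subset_banach)
  have "y summable_on {1, 2} \<union> {2 * 1<..}"
    using y_has_sum_tail[OF B_summable, of 1]
    by (intro summable_on_Un_disjoint) (auto intro: has_sum_imp_summable)
  also have "{1, 2} \<union> {2 * 1<..} = {1::nat..}" by auto
  finally show "y summable_on {1..}" .
qed auto

lemma S_eq: "i \<ge> 1 \<Longrightarrow> S i = (\<Sum>k. x (i + 1 + k) + r (i + k))"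
  unfolding tail_def using y_has_sum_tail[OF B_summable, of i] by (simp add: infsumI)

lemma S_Suc_less_r: "S (Suc i) < r i"
proof -
  have "(\<Sum>k. x (Suc i + 1 + k) + r (Suc i + k)) < r (Suc i - 1)"
    using B[unfolded property_B_def, rule_format, of "Suc i"] by simp
  then show ?thesis
    by (subst S_eq) simp_all
qed

lemma tail_nonneg: "tail i A \<ge> 0"
proof -
  have "y n \<ge> 0" if "n \<in> A \<inter> {2 * i<..}" for n
    using that y_pos[of n] by auto
  then show ?thesis
    unfolding tail_def by (rule infsum_nonneg)
qed

lemma tail_mono:
  assumes "A \<subseteq> A'"
  shows "tail i A \<le> tail i A'"
  unfolding tail_def
proof (intro infsum_mono2 y_summable)
  show "y n \<ge> 0" if "n \<in> A' \<inter> {2 * i<..} - A \<inter> {2 * i<..}" for n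
    using that y_pos[of n] by auto
qed (use assms in auto)

lemma tail_le_S: "tail i A \<le> S i"
  by (rule tail_mono) auto

lemma tail_eq_0_imp: "tail i A \<le> 0 \<Longrightarrow> A \<inter> {2 * i<..} = {}"
proof (rule ccontr)
  assume "tail i A \<le> 0" "A \<inter> {2 * i<..} \<noteq> {}"
  then obtain n where n: "n \<in> A \<inter> {2 * i<..}" by blast
  have "y n = 0"
  proof (rule nonneg_infsum_le_0D[where f = y and A = "A \<inter> {2 * i<..}" and x = n])
    show "infsum y (A \<inter> {2 * i<..}) \<le> 0"
      using \<open>tail i A \<le> 0\<close> by (simp only: tail_def)
    show "y summable_on A \<inter> {2 * i<..}"
      by (rule y_summable) auto
    show "y m \<ge> 0" if "m \<in> A \<inter> {2 * i<..}" for m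
      using that y_pos[of m] by auto
  qed (fact n)
  then show False
    using y_pos[of n] n by auto
qed

lemma tail_Suc:
  "tail i A = (if Suc (2 * i) \<in> A then r i else 0) + (if Suc (Suc (2 * i)) \<in> A then x (Suc i) else 0)
     + tail (Suc i) A"
proof -
  let ?D = "A \<inter> {Suc (2 * i), Suc (Suc (2 * i))}"
  have "A \<inter> {2 * i<..} = ?D \<union> (A \<inter> {2 * Suc i<..})"
    by auto
  then have "tail i A = infsum y (?D \<union> (A \<inter> {2 * Suc i<..}))"
    by (simp only: tail_def)
  also have "\<dots> = infsum y ?D + tail (Suc i) A"
    unfolding tail_def by (intro infsum_Un_disjoint y_summable) auto
  also have "infsum y ?D = sum y ?D" by (rule infsum_finite) simp
  also have "sum y ?D =
      (if Suc (2 * i) \<in> A then r i else 0) + (if Suc (Suc (2 * i)) \<in> A then x (Suc i) else 0)"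
    by (simp add: Int_insert_right y_Suc_double y_Suc_Suc_double)
  finally show ?thesis .
qed

lemma infsum_eq_prefix_tail:
  assumes "A \<subseteq> {1..}"
  shows "infsum y A = sum y (A \<inter> {..2 * i}) + tail i A"
proof -
  have "A = (A \<inter> {..2 * i}) \<union> (A \<inter> {2 * i<..})" by auto
  then have "infsum y A = infsum y ((A \<inter> {..2 * i}) \<union> (A \<inter> {2 * i<..}))" by simp
  also have "\<dots> = infsum y (A \<inter> {..2 * i}) + infsum y (A \<inter> {2 * i<..})"
    using assms by (intro infsum_Un_disjoint y_summable) auto
  finally show ?thesis by (simp add: tail_def)
qed

lemma infsum_eq_tail_0:
  assumes "A \<subseteq> {1..}"
  shows "infsum y A = tail 0 A"
proof -
  have "A \<inter> {..2 * 0} = {}" using assms by auto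
  then show ?thesis
    using infsum_eq_prefix_tail[OF assms, of 0] by simp
qed

text \<open>Index 0 lies in neither set, so the least number of levels on which the sets disagree is
  positive; \<open>i\<close> is its predecessor.\<close>

lemma first_difference:
  assumes "A \<subseteq> {1..}" "C \<subseteq> {1..}" "A \<noteq> C"
  obtains i where "A \<inter> {..2 * i} = C \<inter> {..2 * i}"
    "\<not> ((Suc (2 * i) \<in> A \<longleftrightarrow> Suc (2 * i) \<in> C) \<and> (Suc (Suc (2 * i)) \<in> A \<longleftrightarrow> Suc (Suc (2 * i)) \<in> C))"
proof -
  let ?P = "\<lambda>j. A \<inter> {..2 * j} \<noteq> C \<inter> {..2 * j}"
  obtain n where "n \<in> A \<longleftrightarrow> n \<notin> C" using assms(3) by auto
  then have "?P n"
    by (metis Int_iff atMost_iff le_add1 mult_2)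
  define l where "l = (LEAST j. ?P j)"
  have P: "?P l" unfolding l_def using \<open>?P n\<close> by (rule LeastI)
  have "\<not> ?P 0" using assms(1,2) by fastforce
  with P obtain i where i: "l = Suc i"
    by (cases l) simp_all
  have "\<not> ?P i" by (rule not_less_Least) (simp only: l_def[symmetric] i lessI)
  then have eq: "A \<inter> {..2 * i} = C \<inter> {..2 * i}" by simp
  have "{..2 * Suc i} = {..2 * i} \<union> {Suc (2 * i), Suc (Suc (2 * i))}" by auto
  then have "A \<inter> {Suc (2 * i), Suc (Suc (2 * i))} \<noteq> C \<inter> {Suc (2 * i), Suc (Suc (2 * i))}"
    using P eq unfolding i by (simp only: Int_Un_distrib) auto
  with eq show ?thesis
    by (intro that[of i]) auto
qed

lemma subset_eqI_prefix_tail: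
  fixes A C :: "nat set"
  assumes "A \<inter> {..2 * i} = C \<inter> {..2 * i}" "A \<inter> {2 * i<..} = C \<inter> {2 * i<..}"
  shows "A = C"
proof -
  have "{..2 * i} \<union> {2 * i<..} = UNIV" by auto
  then show ?thesis using assms by (metis Int_Un_distrib inf_top_right)
qed

lemma cardinal_function_eq: "cardinal_function y t = cardinal_of (reps t)"
  unfolding cardinal_function_def reps_def
  by (intro arg_cong[where f = cardinal_of]) (auto simp: has_sum_iff y_summable)

lemma reps_lepoll: "reps t \<lesssim> (UNIV :: nat set set)"
  by (rule subset_imp_lepoll) auto

lemma S_less_x_if_property_A:
  assumes "property_A x"
  shows "S (Suc i) < x (Suc i)"
proof -
  have "(\<Sum>k. x (Suc i + 1 + k) + r (Suc i + k)) < x (Suc i)"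
    using assms[unfolded property_A_def, rule_format, of "Suc i"] by simp
  then show ?thesis
    by (subst S_eq) simp_all
qed

section \<open>Subsums of the original series\<close>

lemma repsD: "A \<in> reps t \<Longrightarrow> A \<subseteq> {1..}" "A \<in> reps t \<Longrightarrow> infsum y A = t"
  by (auto simp: reps_def)

text \<open>The common prefixes cancel. The values \<open>s\<close> and \<open>t\<close> may differ
  because \<open>reps_fin\<close> compares representations of two different numbers.\<close>

lemma reps_first_difference:
  assumes "A \<in> reps s" "C \<in> reps t" "A \<noteq> C"
  obtains i where "A \<inter> {..2 * i} = C \<inter> {..2 * i}" "tail i A - tail i C = s - t"
    "\<not> ((Suc (2 * i) \<in> A \<longleftrightarrow> Suc (2 * i) \<in> C) \<and> (Suc (Suc (2 * i)) \<in> A \<longleftrightarrow> Suc (Suc (2 * i)) \<in> C))"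
proof -
  obtain i where i: "A \<inter> {..2 * i} = C \<inter> {..2 * i}"
    "\<not> ((Suc (2 * i) \<in> A \<longleftrightarrow> Suc (2 * i) \<in> C) \<and> (Suc (Suc (2 * i)) \<in> A \<longleftrightarrow> Suc (Suc (2 * i)) \<in> C))"
    using first_difference repsD(1) assms by metis
  have "tail i A - tail i C = s - t"
    using infsum_eq_prefix_tail[OF repsD(1)[OF assms(1)], of i]
      infsum_eq_prefix_tail[OF repsD(1)[OF assms(2)], of i] i(1) repsD(2) assms(1,2) by simp
  with i show ?thesis by (intro that[of i])
qed

abbreviation evens :: "nat set \<Rightarrow> nat set" where "evens F \<equiv> (*) 2 ` F"

text \<open>Replaces the terms \<open>x (i + 1), x (i + 2), \<dots>\<close> of \<open>evens F\<close> by their sum \<open>r i\<close>.\<close>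
definition cut :: "nat set \<Rightarrow> nat \<Rightarrow> nat set" where
  "cut F i = insert (Suc (2 * i)) (evens (F \<inter> {..i}))"

lemma evens_iff: "Suc (2 * i) \<notin> evens F" "Suc (Suc (2 * i)) \<in> evens F \<longleftrightarrow> Suc i \<in> F"
proof -
  show "Suc (2 * i) \<notin> evens F"
    by (auto simp: Suc_double_not_eq_double)
  have "Suc (Suc (2 * i)) = 2 * Suc i" by simp
  moreover have "2 * Suc i \<in> evens F \<longleftrightarrow> Suc i \<in> F"
    by (rule inj_image_mem_iff) (simp add: inj_def)
  ultimately show "Suc (Suc (2 * i)) \<in> evens F \<longleftrightarrow> Suc i \<in> F"
    by (simp only:)
qed

lemma evens_subset: "F \<subseteq> {1..} \<Longrightarrow> evens F \<subseteq> {1..}"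
  by force

lemma infsum_evens:
  assumes "F \<subseteq> {1..}"
  shows "infsum y (evens F) = infsum x F"
proof -
  have "infsum y (evens F) = infsum (y \<circ> (*) 2) F"
    by (rule infsum_reindex) (simp add: inj_on_def)
  also have "\<dots> = infsum x F"
    using assms y_even by (intro infsum_cong) auto
  finally show ?thesis .
qed

lemma tail_evens:
  assumes "F \<subseteq> {1..}"
  shows "tail i (evens F) = infsum x (F \<inter> {i<..})"
proof -
  have "evens F \<inter> {2 * i<..} = evens (F \<inter> {i<..})" by auto
  then show ?thesis
    unfolding tail_def using assms by (simp only:) (rule infsum_evens, auto)
qed

lemma infsum_x_Ioi: "infsum x {i<..} = r i"
  using x_has_sum by (rule infsumI)

lemma infsum_x_less_r:
  assumes "\<not> {i<..} \<subseteq> F"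
  shows "infsum x (F \<inter> {i<..}) < r i"
proof -
  obtain n where n: "n > i" "n \<notin> F" using assms by auto
  have "infsum x ({n} \<union> (F \<inter> {i<..})) = infsum x {n} + infsum x (F \<inter> {i<..})"
    using n by (intro infsum_Un_disjoint x_summable) auto
  moreover have "infsum x ({n} \<union> (F \<inter> {i<..})) \<le> infsum x {i<..}"
  proof (intro infsum_mono2 x_summable)
    show "x m \<ge> 0" if "m \<in> {i<..} - ({n} \<union> (F \<inter> {i<..}))" for m
      using that pos[of m] by auto
  qed (use n in auto)
  ultimately show ?thesis
    using pos[of n] n by (simp add: infsum_x_Ioi)
qed

text \<open>(B) suffices: \<open>S (Suc i)\<close> is at least
  \<open>r (Suc i) + x (Suc (Suc i)) + r (Suc (Suc i))\<close>, which is
  \<open>2 * r (Suc i)\<close>, and it is below \<open>r i = x (Suc i) + r (Suc i)\<close>.\<close>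

lemma r_less_x: "r (Suc i) < x (Suc i)"
proof -
  have "r (Suc (Suc i)) \<le> S (Suc (Suc i))"
    using tail_Suc[of "Suc (Suc i)" UNIV] tail_nonneg[of "Suc (Suc (Suc i))" UNIV]
      pos[of "Suc (Suc (Suc i))"] by simp
  then show ?thesis
    using S_Suc_less_r[of i] tail_Suc[of "Suc i" UNIV] r_Suc[of i] r_Suc[of "Suc i"] by simp
qed

lemma infsum_y_cut:
  assumes "F \<subseteq> {1..}" "{i<..} \<subseteq> F"
  shows "infsum y (cut F i) = infsum x F"
proof -
  have Fi: "F \<inter> {..i} \<subseteq> {1..}" using assms(1) by auto
  have "infsum y ({Suc (2 * i)} \<union> evens (F \<inter> {..i})) = r i + infsum x (F \<inter> {..i})"
    using evens_subset[OF Fi] evens_iff(1)[of i]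
    by (subst infsum_Un_disjoint) (auto simp: infsum_evens[OF Fi] y_Suc_double intro!: y_summable)
  moreover have "infsum x ((F \<inter> {..i}) \<union> {i<..}) = infsum x (F \<inter> {..i}) + r i"
    using Fi by (subst infsum_Un_disjoint) (auto simp: infsum_x_Ioi intro!: x_summable)
  moreover have "(F \<inter> {..i}) \<union> {i<..} = F"
    using assms(2) by auto
  ultimately show ?thesis
    by (simp add: cut_def)
qed

text \<open>At the first level where \<open>A\<close> differs from \<open>evens F\<close>, the
  remaining sum is at most \<open>r i\<close>, with equality only if
  \<open>{i<..} \<subseteq> F\<close>. Without equality \<open>r i\<close> does not fit and no other
  change is possible; with equality \<open>A\<close> must take \<open>r i\<close> and nothing else.
  The second alternative of \<open>gap\<close> serves (1), where only (B) is available.\<close>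

lemma reps_infsum_x:
  assumes F: "F \<subseteq> {1..}" and gap: "property_A x \<or> (\<exists>n. F = {n<..})"
  shows "reps (infsum x F) = insert (evens F) (cut F ` {i. {i<..} \<subseteq> F})"
proof (intro equalityI subsetI)
  fix A assume "A \<in> insert (evens F) (cut F ` {i. {i<..} \<subseteq> F})"
  then consider "A = evens F" | i where "A = cut F i" "{i<..} \<subseteq> F"
    by auto
  then show "A \<in> reps (infsum x F)"
  proof cases
    case 1
    then show ?thesis
      using evens_subset[OF F] infsum_evens[OF F] by (simp add: reps_def)
  next
    case 2
    moreover have "cut F i \<subseteq> {1..}"
      unfolding cut_def using F by force
    ultimately show ?thesis
      using infsum_y_cut[OF F 2(2)] by (simp add: reps_def)
  qed
next
  fix A assume A: "A \<in> reps (infsum x F)"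
  show "A \<in> insert (evens F) (cut F ` {i. {i<..} \<subseteq> F})"
  proof (cases "A = evens F")
    case False
    have "evens F \<in> reps (infsum x F)"
      using evens_subset[OF F] infsum_evens[OF F] by (simp add: reps_def)
    with A obtain i where i: "A \<inter> {..2 * i} = evens F \<inter> {..2 * i}"
      and tail: "tail i A - tail i (evens F) = infsum x F - infsum x F"
      and diff: "\<not> ((Suc (2 * i) \<in> A \<longleftrightarrow> Suc (2 * i) \<in> evens F)
          \<and> (Suc (Suc (2 * i)) \<in> A \<longleftrightarrow> Suc (Suc (2 * i)) \<in> evens F))"
      using False by (rule reps_first_difference)
    have tail: "tail i A = infsum x (F \<inter> {i<..})"
      using tail by (simp add: tail_evens[OF F])
    have diff: "Suc (2 * i) \<in> A \<or> (Suc (Suc (2 * i)) \<in> A \<longleftrightarrow> Suc i \<notin> F)"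
      using diff by (auto simp: evens_iff)
    have sub: "{i<..} \<subseteq> F"
    proof (rule ccontr)
      assume nsub: "\<not> {i<..} \<subseteq> F"
      then have "infsum x (F \<inter> {i<..}) < r i"
        by (rule infsum_x_less_r)
      then have nin: "Suc (2 * i) \<notin> A"
        using tail tail_Suc[of i A] tail_nonneg[of "Suc i" A] pos[of "Suc i"] by (auto split: if_splits)
      with gap show False
      proof (elim disjE exE)
        assume "property_A x"
        then have S: "S (Suc i) < x (Suc i)" by (rule S_less_x_if_property_A)
        \<comment> \<open>Exactly one of the two sets contains the term \<open>x (Suc i)\<close>,
          and by (A) all later terms together cannot make up for it.\<close>
        have "tail i A = tail i (evens F)" by (simp add: tail tail_evens[OF F])
        then show False
          using nin diff S tail_Suc[of i A] tail_Suc[of i "evens F"]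
            tail_nonneg[of "Suc i" A] tail_nonneg[of "Suc i" "evens F"]
            tail_le_S[of "Suc i" A] tail_le_S[of "Suc i" "evens F"]
          by (cases "Suc i \<in> F") (simp_all add: evens_iff)
      next
        fix n assume n: "F = {n<..}"
        \<comment> \<open>Here \<open>A\<close> would have to contain \<open>x (Suc i)\<close>,
          which by \<open>r_less_x\<close> exceeds \<open>r (Suc i)\<close> and hence the whole
          remaining sum \<open>r n\<close>.\<close>
        with nsub have "Suc i \<notin> F" "F \<inter> {i<..} = {n<..}" "Suc i \<le> n" by auto
        then have "tail i A = r n" using tail by (simp add: infsum_x_Ioi)
        moreover have "x (Suc i) \<le> tail i A"
          using tail_Suc[of i A] diff nin \<open>Suc i \<notin> F\<close> tail_nonneg[of "Suc i" A] by simp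
        moreover have "r n \<le> r (Suc i)"
          using \<open>Suc i \<le> n\<close>
        proof (rule lift_Suc_antimono_le[rotated])
          show "r (Suc m) \<le> r m" for m
            using r_Suc[of m] pos[of "Suc m"] by simp
        qed
        ultimately show False
          using r_less_x[of i] by simp
      qed
    qed
    then have "F \<inter> {i<..} = {i<..}" by auto
    then have tail_eq: "tail i A = r i"
      using tail by (simp add: infsum_x_Ioi)
    \<comment> \<open>Otherwise \<open>A\<close> takes neither term of this level, and by (B) the
      later terms do not reach \<open>r i\<close>.\<close>
    have in_A: "Suc (2 * i) \<in> A"
    proof (rule ccontr)
      assume "Suc (2 * i) \<notin> A"
      moreover from this have "Suc (Suc (2 * i)) \<notin> A" using diff sub by auto
      ultimately show False
        using tail_eq tail_Suc[of i A] tail_le_S[of "Suc i" A] S_Suc_less_r[of i] by simp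
    qed
    have notin_A: "Suc (Suc (2 * i)) \<notin> A"
      using tail_eq tail_Suc[of i A] in_A tail_nonneg[of "Suc i" A] pos[of "Suc i"] by (auto split: if_splits)
    have "tail (Suc i) A \<le> 0"
      using tail_eq tail_Suc[of i A] in_A notin_A by simp
    then have "A \<inter> {2 * Suc i<..} = {}" by (rule tail_eq_0_imp)
    moreover have "{2 * i<..} = {Suc (2 * i), Suc (Suc (2 * i))} \<union> {2 * Suc i<..}" by auto
    ultimately have "A \<inter> {2 * i<..} = {Suc (2 * i)}"
      using in_A notin_A by auto
    moreover have "cut F i \<inter> {2 * i<..} = {Suc (2 * i)}" "cut F i \<inter> {..2 * i} = evens F \<inter> {..2 * i}"
      by (auto simp: cut_def)
    ultimately have "A = cut F i"
      by (intro subset_eqI_prefix_tail[of A i "cut F i"]) (simp_all only: i)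
    with sub show ?thesis by blast
  qed simp
qed

text \<open>The only odd index in \<open>cut F i\<close> determines \<open>i\<close>.\<close>

lemma inj_cut: "inj (cut F)"
proof (rule injI)
  fix i j assume "cut F i = cut F j"
  then have "Suc (2 * i) \<in> cut F j" by (auto simp: cut_def)
  then show "i = j"
    using evens_iff(1)[of i "F \<inter> {..j}"] by (simp add: cut_def)
qed

lemma cardinal_function_cofinite:
  assumes "F \<subseteq> {1..}" "property_A x \<or> (\<exists>n. F = {n<..})" "finite ({1..} - F)"
  shows "cardinal_function y (infsum x F) = card_omega"
proof -
  obtain m where m: "\<And>n. n \<in> {1..} - F \<Longrightarrow> n \<le> m"
    using assms(3) unfolding finite_nat_set_iff_bounded_le by blast
  have "n \<in> F" if "m \<le> i" "i < n" for i n
    using m[of n] that by (cases "n \<in> F") auto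
  then have "{m..} \<subseteq> {i. {i<..} \<subseteq> F}"
    by auto
  then have "infinite {i. {i<..} \<subseteq> F}"
    using infinite_Ici[of m] infinite_super by blast
  then have "infinite (cut F ` {i. {i<..} \<subseteq> F})"
    using finite_image_iff[OF inj_on_subset[OF inj_cut subset_UNIV]] by simp
  then show ?thesis
    unfolding cardinal_function_eq reps_infsum_x[OF assms(1,2)]
    by (intro countable_infinite_cardinal_of) auto
qed

text \<open>\<open>r n\<close> is the subsum over \<open>{n<..}\<close>, the second alternative of
  \<open>gap\<close>.\<close>

lemma cardinal_function_r: "cardinal_function y (r n) = card_omega"
proof -
  have "{1..} - {n<..} \<subseteq> {..n}" by auto
  then have "finite ({1..} - {n<..})" using finite_subset by blast
  then show ?thesis
    using cardinal_function_cofinite[of "{n<..}"] by (force simp: infsum_x_Ioi)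
qed

text \<open>No final segment lies in \<open>F\<close>, so there is nothing to collapse and only
  \<open>evens F\<close> remains.\<close>

lemma cardinal_function_coinfinite:
  assumes "property_A x" "F \<subseteq> {1..}" "infinite ({1..} - F)"
  shows "cardinal_function y (infsum x F) = card_fin 1"
proof -
  have "\<not> {i<..} \<subseteq> F" for i
  proof
    assume "{i<..} \<subseteq> F"
    then have "{1..} - F \<subseteq> {..i}"
      by (meson DiffD2 atMost_iff greaterThan_iff not_le subset_iff)
    with assms(3) show False using finite_subset by blast
  qed
  then have "reps (infsum x F) = {evens F}"
    using reps_infsum_x[OF assms(2)] assms(1) by simp
  then show ?thesis
    unfolding cardinal_function_eq by (simp add: finite_cardinal_of)
qed

section \<open>Values attained finitely often\<close>

text \<open>The relation \<open>r 0 = x 1 + \<dots> + x j + r j\<close> plus both terms of the level \<open>k + 1\<close>.\<close>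
definition rep_fin :: "nat \<Rightarrow> nat \<Rightarrow> nat set" where
  "rep_fin k j = cut {1..} j \<union> {Suc (2 * k), Suc (Suc (2 * k))}"

lemma infsum_x_atLeast_1: "infsum x {1..} = r 0"
proof -
  have "{0<..} = {1::nat..}" by auto
  then show ?thesis using infsum_x_Ioi[of 0] by simp
qed

lemma sum_y_level: "sum y {Suc (2 * k), Suc (Suc (2 * k))} = r k + x (Suc k)"
  by (simp add: y_Suc_double y_Suc_Suc_double)

lemma rep_fin_iff:
  assumes "j < l"
  shows "Suc (2 * l) \<in> rep_fin k j \<longleftrightarrow> l = k" "Suc (Suc (2 * l)) \<in> rep_fin k j \<longleftrightarrow> l = k"
proof -
  show "Suc (2 * l) \<in> rep_fin k j \<longleftrightarrow> l = k"
    using assms evens_iff(1)[of l "{1..} \<inter> {..j}"] double_not_eq_Suc_double[of l k]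
    by (simp add: rep_fin_def cut_def)
  show "Suc (Suc (2 * l)) \<in> rep_fin k j \<longleftrightarrow> l = k"
    using assms evens_iff(2)[of l "{1..} \<inter> {..j}"] Suc_double_not_eq_double[of l j] Suc_double_not_eq_double[of l k]
    by (auto simp add: rep_fin_def cut_def)
qed

text \<open>For \<open>j < k\<close> the cut stays within the first \<open>k\<close> levels and is
  disjoint from the added level; for larger \<open>j\<close> it would use a term of that level
  itself. This is why the count is exactly \<open>k\<close>.\<close>

lemma rep_fin_in_reps:
  assumes "j < k"
  shows "rep_fin k j \<in> reps (r 0 + (r k + x (Suc k)))"
proof -
  have cut: "cut {1..} j \<subseteq> {1..}" by (force simp: cut_def)
  have "infsum y (rep_fin k j) = infsum y (cut {1..} j) + infsum y {Suc (2 * k), Suc (Suc (2 * k))}"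
    unfolding rep_fin_def
  proof (intro infsum_Un_disjoint y_summable)
    show "cut {1..} j \<inter> {Suc (2 * k), Suc (Suc (2 * k))} = {}"
      using assms by (auto simp: cut_def)
  qed (use cut in auto)
  also have "infsum y (cut {1..} j) = r 0"
    by (subst infsum_y_cut) (use infsum_x_atLeast_1 in auto)
  also have "infsum y {Suc (2 * k), Suc (Suc (2 * k))} = r k + x (Suc k)"
    by (subst infsum_finite) (simp_all only: sum_y_level finite.intros)
  finally show ?thesis
    using cut by (simp add: reps_def rep_fin_def)
qed

lemma level_le_S:
  assumes "i \<le> k"
  shows "r k + x (Suc k) \<le> S i"
proof -
  have "{Suc (2 * k), Suc (Suc (2 * k))} \<inter> {2 * i<..} = {Suc (2 * k), Suc (Suc (2 * k))}"
    using assms by auto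
  then have "tail i {Suc (2 * k), Suc (Suc (2 * k))} = r k + x (Suc k)"
    unfolding tail_def by (simp only: infsum_finite finite.intros sum_y_level)
  then show ?thesis
    using tail_le_S[of i "{Suc (2 * k), Suc (Suc (2 * k))}"] by simp
qed

lemma x_less_r: "x (Suc i) < r i"
  using r_Suc[of i] r_pos[of "Suc i"] by simp

text \<open>At every level past the cut \<open>rep_fin k i\<close> has both terms or none, so a
  difference there means only additional or only missing terms, and by (A) these outweigh everything
  later.\<close>

lemma rep_fin_unique:
  assumes A: "property_A x" and "i < k" and rep: "C \<in> reps (r 0 + (r k + x (Suc k)))"
    and prefix: "C \<inter> {..2 * Suc i} = rep_fin k i \<inter> {..2 * Suc i}"
  shows "C = rep_fin k i"
proof (rule ccontr)
  assume neq: "C \<noteq> rep_fin k i"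
  obtain l where tails: "tail l C - tail l (rep_fin k i) = r 0 + (r k + x (Suc k)) - (r 0 + (r k + x (Suc k)))"
    and diff: "\<not> ((Suc (2 * l) \<in> C \<longleftrightarrow> Suc (2 * l) \<in> rep_fin k i)
      \<and> (Suc (Suc (2 * l)) \<in> C \<longleftrightarrow> Suc (Suc (2 * l)) \<in> rep_fin k i))"
    using rep rep_fin_in_reps[OF \<open>i < k\<close>] neq by (rule reps_first_difference)
  have "i < l"
  proof (rule ccontr)
    assume "\<not> i < l"
    then have "{Suc (2 * l), Suc (Suc (2 * l))} \<subseteq> {..2 * Suc i}" by auto
    then show False using prefix diff by blast
  qed
  have S: "S (Suc l) < x (Suc l)"
    using A by (rule S_less_x_if_property_A)
  have diff': "\<not> ((Suc (2 * l) \<in> C \<longleftrightarrow> l = k) \<and> (Suc (Suc (2 * l)) \<in> C \<longleftrightarrow> l = k))"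
    using diff unfolding rep_fin_iff[OF \<open>i < l\<close>] .
  have T: "tail l C = (if l = k then r l else 0) + (if l = k then x (Suc l) else 0) + tail (Suc l) (rep_fin k i)"
    using tails tail_Suc[of l "rep_fin k i"] by (simp only: rep_fin_iff[OF \<open>i < l\<close>])
  note bounds = tail_Suc[of l C] tail_nonneg[of "Suc l" C] tail_nonneg[of "Suc l" "rep_fin k i"]
    tail_le_S[of "Suc l" C] tail_le_S[of "Suc l" "rep_fin k i"] x_less_r[of l] pos[of "Suc l"]
  show False
  proof (cases "l = k")
    case True
    then show False
      using diff' T bounds S by (auto split: if_splits)
  next
    case False
    then show False
      using diff' T bounds S by (auto split: if_splits)
  qed
qed

lemma reps_fin:
  assumes A: "property_A x"
  shows "reps (r 0 + (r k + x (Suc k))) = rep_fin k ` {..<k}"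
proof (intro equalityI subsetI)
  fix C assume C: "C \<in> reps (r 0 + (r k + x (Suc k)))"
  \<comment> \<open>The fully unfolded representation of \<open>r 0\<close>; the place where
    \<open>C\<close> departs from it is the cut.\<close>
  define E where "E = evens {1..}"
  have E: "E \<in> reps (r 0)" "\<And>i. tail i E = r i"
  proof -
    show "E \<in> reps (r 0)"
      using evens_subset[of "{1..}"] infsum_evens[of "{1..}"] infsum_x_atLeast_1
      by (simp add: reps_def E_def)
    fix i :: nat
    have "{1..} \<inter> {i<..} = {i<..}" by auto
    then show "tail i E = r i"
      unfolding E_def by (subst tail_evens) (simp_all only: infsum_x_Ioi order_refl)
  qed
  have u: "r k + x (Suc k) > 0"
    using r_pos[of k] pos[of "Suc k"] by simp
  then have "C \<noteq> E"
    using repsD(2)[OF C] repsD(2)[OF E(1)] by auto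
  with C E(1) obtain i where i: "C \<inter> {..2 * i} = E \<inter> {..2 * i}"
    and tails: "tail i C - tail i E = r 0 + (r k + x (Suc k)) - r 0"
    and diff: "\<not> ((Suc (2 * i) \<in> C \<longleftrightarrow> Suc (2 * i) \<in> E) \<and> (Suc (Suc (2 * i)) \<in> C \<longleftrightarrow> Suc (Suc (2 * i)) \<in> E))"
    by (rule reps_first_difference)
  have tail_C: "tail i C = r i + (r k + x (Suc k))"
    using tails E(2) by simp
  \<comment> \<open>Agreement with \<open>E\<close> on the first \<open>k\<close> levels would leave
    \<open>C\<close> the tail \<open>2 * r k + x (Suc k)\<close>, more than \<open>S k\<close> by
    (B).\<close>
  have "i < k"
  proof (rule ccontr)
    assume "\<not> i < k"
    then have "{..2 * k} = {..2 * i} \<inter> {..2 * k}" by auto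
    with i have "C \<inter> {..2 * k} = E \<inter> {..2 * k}" by (metis Int_assoc)
    then have "tail k C = r k + (r k + x (Suc k))"
      using infsum_eq_prefix_tail[OF repsD(1)[OF C], of k] infsum_eq_prefix_tail[OF repsD(1)[OF E(1)], of k]
        repsD(2)[OF C] repsD(2)[OF E(1)] E(2)[of k] by simp
    then show False
      using tail_le_S[of k C] tail_Suc[of k UNIV] S_Suc_less_r[of k] by simp
  qed
  have E_iff: "Suc (2 * i) \<notin> E" "Suc (Suc (2 * i)) \<in> E"
    unfolding E_def by (simp_all only: evens_iff) simp_all
  note bounds = tail_Suc[of i C] tail_nonneg[of "Suc i" C] tail_le_S[of "Suc i" C] S_Suc_less_r[of i]
    level_le_S[of "Suc i" k] S_less_x_if_property_A[OF A, of i]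
  \<comment> \<open>The surplus \<open>r k + x (Suc k)\<close> is at most \<open>S (Suc i)\<close>,
    hence below \<open>x (Suc i)\<close>. So taking both terms of the level is too much, taking
    neither is too little by (B), and \<open>x (Suc i)\<close> alone is the choice of
    \<open>E\<close>.\<close>
  have in_C: "Suc (2 * i) \<in> C" "Suc (Suc (2 * i)) \<notin> C"
    using diff E_iff bounds tail_C u \<open>i < k\<close> by (auto split: if_splits)
  have "C = rep_fin k i"
  proof (rule rep_fin_unique[OF A \<open>i < k\<close> C])
    have *: "{..2 * Suc i} = {..2 * i} \<union> {Suc (2 * i), Suc (Suc (2 * i))}" by auto
    have "C \<inter> {..2 * Suc i} = insert (Suc (2 * i)) (E \<inter> {..2 * i})"
      using in_C i unfolding * Int_Un_distrib by auto
    also have "\<dots> = rep_fin k i \<inter> {..2 * Suc i}"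
      using \<open>i < k\<close> by (auto simp: rep_fin_def cut_def E_def)
    finally show "C \<inter> {..2 * Suc i} = rep_fin k i \<inter> {..2 * Suc i}" .
  qed
  then show "C \<in> rep_fin k ` {..<k}"
    using \<open>i < k\<close> by blast
qed (use rep_fin_in_reps in auto)

lemma cardinal_function_fin:
  assumes "property_A x"
  shows "cardinal_function y (r 0 + (r k + x (Suc k))) = card_fin k"
proof -
  have "inj_on (rep_fin k) {..<k}"
  proof (rule inj_onI)
    fix i j assume ij: "i \<in> {..<k}" "j \<in> {..<k}" "rep_fin k i = rep_fin k j"
    have "Suc (2 * i) \<in> rep_fin k i" "Suc (2 * j) \<in> rep_fin k j"
      by (auto simp: rep_fin_def cut_def)
    then show "i = j"
      using ij rep_fin_iff(1)[of i j k] rep_fin_iff(1)[of j i k] by (cases i j rule: linorder_cases) auto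
  qed
  then have "card (rep_fin k ` {..<k}) = k"
    by (simp add: card_image)
  then show ?thesis
    unfolding cardinal_function_eq reps_fin[OF assms] by (simp add: finite_cardinal_of)
qed

section \<open>Values attained continuum many times\<close>

text \<open>Block \<open>m\<close> consists of the levels \<open>3 * m + 1\<close> to
  \<open>3 * m + 3\<close>. \<open>D\<close> varies the representation of a fixed value;
  \<open>E\<close> varies the value through the optional term \<open>x (3 * m + 3)\<close>.\<close>

definition rep_cont :: "nat set \<Rightarrow> nat set \<Rightarrow> nat set" where
  "rep_cont D E = {n. \<exists>m. n = Suc (2 * (3 * m)) \<and> m \<notin> D \<or> n = Suc (Suc (2 * (3 * m))) \<and> m \<in> D
     \<or> n = Suc (2 * Suc (3 * m)) \<and> m \<in> D \<or> n = Suc (Suc (2 * Suc (Suc (3 * m)))) \<and> m \<in> E}"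

lemma rep_cont_subset: "rep_cont D E \<subseteq> {1..}"
  by (auto simp: rep_cont_def)

lemma rep_cont_iff:
  "Suc (2 * (3 * m)) \<in> rep_cont D E \<longleftrightarrow> m \<notin> D"
  "Suc (Suc (2 * (3 * m))) \<in> rep_cont D E \<longleftrightarrow> m \<in> D"
  "Suc (2 * Suc (3 * m)) \<in> rep_cont D E \<longleftrightarrow> m \<in> D"
  "Suc (Suc (2 * Suc (3 * m))) \<notin> rep_cont D E"
  "Suc (2 * Suc (Suc (3 * m))) \<notin> rep_cont D E"
  "Suc (Suc (2 * Suc (Suc (3 * m)))) \<in> rep_cont D E \<longleftrightarrow> m \<in> E"
proof -
  \<comment> \<open>A block has six indices, so membership is decided by residues modulo 6.\<close>
  have "6 * a \<noteq> Suc (6 * b)" "6 * a \<noteq> Suc (Suc (6 * b))" "6 * a \<noteq> Suc (Suc (Suc (6 * b)))"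
    "6 * a \<noteq> Suc (Suc (Suc (Suc (6 * b))))" "6 * a \<noteq> Suc (Suc (Suc (Suc (Suc (6 * b)))))" for a b :: nat
    by presburger+
  note residues = this this[symmetric]
  show "Suc (2 * (3 * m)) \<in> rep_cont D E \<longleftrightarrow> m \<notin> D"
    "Suc (Suc (2 * (3 * m))) \<in> rep_cont D E \<longleftrightarrow> m \<in> D"
    "Suc (2 * Suc (3 * m)) \<in> rep_cont D E \<longleftrightarrow> m \<in> D"
    "Suc (Suc (2 * Suc (3 * m))) \<notin> rep_cont D E"
    "Suc (2 * Suc (Suc (3 * m))) \<notin> rep_cont D E"
    "Suc (Suc (2 * Suc (Suc (3 * m)))) \<in> rep_cont D E \<longleftrightarrow> m \<in> E"
    by (auto simp: rep_cont_def residues)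
qed

text \<open>By (B), \<open>S (Suc n)\<close> is squeezed between 0 and \<open>r n\<close>.\<close>

lemma S_tendsto_0: "S \<longlonglongrightarrow> 0"
proof -
  have "(\<lambda>k. x (0 + 1 + k)) sums r 0"
    using summable_ignore_initial_segment[OF conv, of 1]
    unfolding remainder_def by (simp add: add_ac summable_sums)
  then have "(\<lambda>n. r 0 - (\<Sum>i<n. x (Suc i))) \<longlonglongrightarrow> r 0 - r 0"
    by (intro tendsto_intros) (simp add: sums_def)
  moreover have "r 0 - (\<Sum>i<n. x (Suc i)) = r n" for n
  proof (induction n)
    case (Suc n)
    then show ?case using r_Suc[of n] by simp
  qed simp
  ultimately have "r \<longlonglongrightarrow> 0" by simp
  then have "(\<lambda>n. S (Suc n)) \<longlonglongrightarrow> 0"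
  proof (rule tendsto_sandwich[rotated 3, OF _ _ _ tendsto_const])
    show "\<forall>\<^sub>F n in sequentially. 0 \<le> S (Suc n)"
      by (intro always_eventually allI tail_nonneg)
    show "\<forall>\<^sub>F n in sequentially. S (Suc n) \<le> r n"
      by (intro always_eventually allI less_imp_le S_Suc_less_r)
  qed
  then show ?thesis by (rule LIMSEQ_imp_Suc)
qed

text \<open>
  In each block of three levels the choice made by \<open>D\<close> trades the term \<open>r (3 m)\<close> for
  \<open>x (3 m + 1) + r (3 m + 1)\<close>, which leaves the sum unchanged.
\<close>
lemma infsum_rep_cont: "infsum y (rep_cont D E) = infsum y (rep_cont D' E)"
proof -
  let ?d = "\<lambda>i. tail i (rep_cont D E) - tail i (rep_cont D' E)"
  have "?d (3 * m) = ?d 0" for m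
  proof (induction m)
    case (Suc m)
    have "tail (3 * m) (rep_cont D E) = r (3 * m) + (if m \<in> E then x (Suc (Suc (Suc (3 * m)))) else 0)
        + tail (Suc (Suc (Suc (3 * m)))) (rep_cont D E)" for D
      using tail_Suc[of "3 * m" "rep_cont D E"] tail_Suc[of "Suc (3 * m)" "rep_cont D E"]
        tail_Suc[of "Suc (Suc (3 * m))" "rep_cont D E"] r_Suc[of "3 * m"]
      by (simp only: rep_cont_iff) (simp split: if_splits)
    moreover have "3 * Suc m = Suc (Suc (Suc (3 * m)))" by simp
    ultimately show ?case
      using Suc by (simp only:)
  qed simp
  \<comment> \<open>Both tails lie between 0 and \<open>S (3 * m)\<close>, so the difference,
    constant at block ends, must vanish.\<close>
  moreover have "(\<lambda>m. ?d (3 * m)) \<longlonglongrightarrow> 0"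
  proof (rule Lim_null_comparison)
    show "\<forall>\<^sub>F m in sequentially. norm (?d (3 * m)) \<le> S (3 * m)"
      using tail_nonneg[of "3 * m" for m] tail_le_S[of "3 * m" for m]
      by (intro always_eventually allI) (smt (verit) real_norm_def)
    show "(\<lambda>m. S (3 * m)) \<longlonglongrightarrow> 0"
      using LIMSEQ_subseq_LIMSEQ[OF S_tendsto_0, of "\<lambda>m. 3 * m"] by (simp add: strict_mono_def o_def)
  qed
  ultimately have "?d 0 = 0"
    by (simp add: LIMSEQ_const_iff)
  then show ?thesis
    by (simp add: infsum_eq_tail_0[OF rep_cont_subset])
qed

text \<open>Different \<open>D\<close> give different representations of the same value, one for
  each set of naturals.\<close>

lemma cardinal_function_rep_cont: "cardinal_function y (infsum y (rep_cont {} E)) = card_continuum"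
  unfolding cardinal_function_eq
proof (rule cardinal_of_continuum)
  have "inj (\<lambda>D. rep_cont D E)"
    by (rule injI) (metis rep_cont_iff(2) set_eqI)
  moreover have "range (\<lambda>D. rep_cont D E) \<subseteq> reps (infsum y (rep_cont {} E))"
    using rep_cont_subset infsum_rep_cont by (auto simp: reps_def)
  ultimately show "(UNIV :: nat set set) \<lesssim> reps (infsum y (rep_cont {} E))"
    unfolding lepoll_def by blast
qed (rule reps_lepoll)

text \<open>With \<open>D\<close> fixed, the first differing level differs only in its
  \<open>x\<close> term, which by (A) outweighs all later terms.\<close>

lemma inj_infsum_rep_cont:
  assumes "property_A x"
  shows "inj (\<lambda>E. infsum y (rep_cont {} E))"
proof (rule injI, rule ccontr)
  fix E E' assume eq: "infsum y (rep_cont {} E) = infsum y (rep_cont {} E')" and "E \<noteq> E'"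
  let ?A = "rep_cont {} E" and ?C = "rep_cont {} E'"
  from \<open>E \<noteq> E'\<close> have "?A \<noteq> ?C"
    by (metis rep_cont_iff(6) set_eqI)
  moreover have "?A \<in> reps (infsum y ?A)" "?C \<in> reps (infsum y ?C)"
    using rep_cont_subset by (auto simp: reps_def)
  ultimately obtain i where tails: "tail i ?A - tail i ?C = infsum y ?A - infsum y ?C"
    and diff: "\<not> ((Suc (2 * i) \<in> ?A \<longleftrightarrow> Suc (2 * i) \<in> ?C) \<and> (Suc (Suc (2 * i)) \<in> ?A \<longleftrightarrow> Suc (Suc (2 * i)) \<in> ?C))"
    using reps_first_difference by metis
  have odd: "Suc (2 * i) \<in> ?A \<longleftrightarrow> Suc (2 * i) \<in> ?C"
    by (auto simp: rep_cont_def) presburger+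
  have "tail i ?A = tail i ?C" using tails eq by simp
  then show False
    using odd diff tail_Suc[of i ?A] tail_Suc[of i ?C] S_less_x_if_property_A[OF assms, of i]
      tail_nonneg[of "Suc i" ?A] tail_nonneg[of "Suc i" ?C] tail_le_S[of "Suc i" ?A] tail_le_S[of "Suc i" ?C]
    by (auto split: if_splits)
qed

lemma cardinal_of_continuum_values:
  assumes "property_A x"
  shows "cardinal_of {t. cardinal_function y t = card_continuum} = card_continuum"
proof (rule cardinal_of_continuum)
  show "(UNIV :: nat set set) \<lesssim> {t. cardinal_function y t = card_continuum}"
    unfolding lepoll_def using inj_infsum_rep_cont[OF assms] cardinal_function_rep_cont by blast
  have "{t. cardinal_function y t = card_continuum} \<lesssim> (UNIV :: real set)"
    by (rule subset_imp_lepoll) simp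
  then show "{t. cardinal_function y t = card_continuum} \<lesssim> (UNIV :: nat set set)"
    using nat_sets_eqpoll_reals eqpoll_sym lepoll_trans2 by blast
qed

section \<open>The range of the cardinal function\<close>

lemma subsums_iff: "t \<in> subsums y \<longleftrightarrow> reps t \<noteq> {}"
  using y_summable by (auto simp: subsums_def reps_def has_sum_iff)

text \<open>Only the uncountable case needs an argument: there closedness of the solution set forces
  continuum many representations.\<close>

lemma cardinal_function_cases:
  assumes "t \<in> subsums y"
  shows "cardinal_function y t \<in> {card_fin k |k. k \<ge> 1} \<union> {card_omega, card_continuum}"
proof -
  consider "finite (reps t)" | "infinite (reps t)" "countable (reps t)" | "uncountable (reps t)"
    by blast
  then show ?thesis
  proof cases
    case 1
    then have "card (reps t) \<ge> 1"
      using assms by (simp add: subsums_iff Suc_le_eq card_gt_0_iff)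
    then show ?thesis
      using finite_cardinal_of[OF 1] unfolding cardinal_function_eq by blast
  next
    case 2
    then show ?thesis
      using countable_infinite_cardinal_of unfolding cardinal_function_eq by blast
  next
    case 3
    then have "(UNIV :: real set) \<lesssim> reps t"
      unfolding reps_def by (intro lepoll_sets_infsum_eq y_summable) auto
    then have "(UNIV :: nat set set) \<lesssim> reps t"
      using nat_sets_eqpoll_reals lepoll_trans1 by blast
    then show ?thesis
      using cardinal_of_continuum[OF _ reps_lepoll] unfolding cardinal_function_eq by blast
  qed
qed

text \<open>The witnesses are \<open>r 0 + (r k + x (Suc k))\<close> for \<open>k\<close>,
  \<open>r 0\<close> for \<open>\<omega>\<close>, and the sum over \<open>rep_cont {} {}\<close> for
  the continuum.\<close>

lemma cardinal_range_eq:
  assumes "property_A x"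
  shows "cardinal_range y = {card_fin k |k. k \<ge> 1} \<union> {card_omega, card_continuum}"
proof (intro equalityI subsetI)
  fix c assume "c \<in> {card_fin k |k. k \<ge> 1} \<union> {card_omega, card_continuum}"
  then consider k where "k \<ge> 1" "c = card_fin k" | "c = card_omega" | "c = card_continuum"
    by auto
  then show "c \<in> cardinal_range y"
  proof cases
    case 1
    let ?t = "r 0 + (r k + x (Suc k))"
    have "rep_fin k 0 \<in> reps ?t"
      using 1(1) by (intro rep_fin_in_reps) simp
    then have "?t \<in> subsums y"
      unfolding subsums_iff by blast
    then show ?thesis
      unfolding cardinal_range_def 1(2) using cardinal_function_fin[OF assms, of k]
      by (intro rev_image_eqI) auto
  next
    case 2
    have "evens {1..} \<in> reps (r 0)"
      using evens_subset[of "{1..}"] infsum_evens[of "{1..}"] infsum_x_atLeast_1 by (simp add: reps_def)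
    then have "r 0 \<in> subsums y"
      unfolding subsums_iff by blast
    then show ?thesis
      unfolding cardinal_range_def 2 using cardinal_function_r[of 0] by (intro rev_image_eqI) auto
  next
    case 3
    let ?t = "infsum y (rep_cont {} {})"
    have "rep_cont {} {} \<in> reps ?t"
      using rep_cont_subset by (simp add: reps_def)
    then have "?t \<in> subsums y"
      unfolding subsums_iff by blast
    then show ?thesis
      unfolding cardinal_range_def 3 using cardinal_function_rep_cont[of "{}"] by (intro rev_image_eqI) auto
  qed
qed (auto simp: cardinal_range_def dest!: cardinal_function_cases)

end

theorem theorem2p2:
  fixes x y :: "nat \<Rightarrow> real"
  assumes pos: "\<And>n. n \<ge> 1 \<Longrightarrow> x n > 0"
    and conv: "summable x"
    and B: "property_B x"
    and y_odd: "\<And>n. n \<ge> 1 \<Longrightarrow> y (2 * n - 1) = remainder x (n - 1)"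
    and y_even: "\<And>n. n \<ge> 1 \<Longrightarrow> y (2 * n) = x n"
  shows "(\<forall>n\<ge>1. cardinal_function y (remainder x n) = card_omega) \<and>
    (property_A x \<longrightarrow>
      (\<forall>n\<ge>1. cardinal_function y (x n) = card_fin 1) \<and>
      (\<forall>F\<subseteq>{1..}. infinite ({1..} - F) \<longrightarrow>
         cardinal_function y (\<Sum>\<^sub>\<infinity>n\<in>F. x n) = card_fin 1) \<and>
      (\<forall>F\<subseteq>{1..}. finite ({1..} - F) \<and> 1 \<le> card ({1..} - F) \<longrightarrow>
         cardinal_function y (\<Sum>\<^sub>\<infinity>n\<in>F. x n) = card_omega) \<and>
      cardinal_of {t. cardinal_function y t = card_continuum} = card_continuum \<and>
      cardinal_range y = {card_fin k |k. k \<ge> 1} \<union> {card_omega, card_continuum})"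
proof -
  interpret interleaved x y
    using assms by unfold_locales
  \<comment> \<open>(2) is the case \<open>F = {n}\<close> of (3).\<close>
  have "cardinal_function y (x n) = card_fin 1" if "property_A x" "n \<ge> 1" for n
  proof -
    have "infinite ({1..} - {n})"
      by (simp add: infinite_Ici)
    then show ?thesis
      using cardinal_function_coinfinite[OF that(1), of "{n}"] that(2) by simp
  qed
  then show ?thesis
    using cardinal_function_r cardinal_function_coinfinite cardinal_function_cofinite
      cardinal_of_continuum_values cardinal_range_eq by simp
qed

end
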